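(* Let $C$ be an $n$-copula and let $R$, $S$, $T$ be disjoint subsets of $\overline n=\{1,\dots,n\}$ such that $\overline n=R+S+T$, $r=\mathrm{card}(R)$, $s=\mathrm{card}(S)$ and $t=\mathrm{card}(T)$. Then for every measure of concordance $\kappa=(\{\kappa_n\},\{r_n\})$ we have $$\sum_{j=s}^{n-t}(-1)^{r+j}\,\mathfrak A_j^R(C_T)=\sum_{j=r}^{n-t}(-1)^{s+j}\,\mathfrak A_j^S(C_T).$$
   Context: Notation. $I=[0,1]$, $\overline{n}=\{1,\dots,n\}$, and $[0,x]=[0,x_1]\times\cdots\times[0,x_n]$ for $x\in I^n$. For $n\ge 1$ an $n$-copula is a function $C:I^n\to I$ for which there is a (necessarily unique) Borel probability measure $\mu_C$ on $I^n$ whose one-dimensional marginals are all Lebesgue measure on $I$ and which satisfies $\mu_C([0,x])=C(x)$. The unique 1-copula is $J(t)=t$; the unique 0-copula is the constant $1$. $M(t_1,\dots,t_n)=\min(t_1,\dots,t_n)$ and $\Pi(t_1,\dots,t_n)=t_1\cdots t_n$. Symmetries. A permutation of $I^n$ is a map $\tau(x_1,\dots,x_n)=(x_{\tau'(1)},\dots,x_{\tau'(n)})$, where $\tau'$ is a permutation of $\overline n$. The elementary reflection $\sigma_i$ of $I^n$ replaces $x_i$ by $1-x_i$ and fixes the other coordinates; $\mathcal{R}_n$ is the group of reflections (compositions of elementary reflections, including the identity), and $\sigma=\sigma_1\cdots\sigma_n$. For a permutation or reflection $\xi$ of $I^n$ and an $n$-copula $C$, $\xi^*(C)$ is the $n$-copula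 $[\xi^*(C)](x)=\mu_C(\xi([0,x]))$. For $n$-copulas $A,B$, $A\prec_{\mathcal C}B$ means $A\le B$ and $\sigma^*(A)\le\sigma^*(B)$ pointwise. Marginals. For an $n$-copula $C$ and $T\subseteq\overline n$ with $t=\mathrm{card}(T)$, $C_T:I^n\to I$ is the function obtained from $C$ by setting $x_i=1$ for all $i\in T$. Its proper copula is the $(n-t)$-copula obtained by regarding $C_T$ as a function of the remaining variables $x_i$, $i\notin T$, listed in increasing order of index; $\kappa_{n-t}(C_T)$ means $\kappa_{n-t}$ of this proper copula. A measure of concordance $\kappa=(\{\kappa_n\},\{r_n\})$ consists of maps $\kappa_n$ from the set of $n$-copulas to $\mathbb R$ and real numbers $r_n$, $n\ge2$, such that for all $n\ge2$ and all $n$-copulas $A,B,C,C_m$: A1 $\kappa_n(M)=1$, $\kappa_n(\Pi)=0$; A2 if $A\prec_{\mathcal C}B$ then $\kappa_n(A)\le\kappa_n(B)$; A3 if $C_m\to C$ uniformly then $\kappa_n(C_m)\to\kappa_n(C)$ as $m\to\infty$; A4 $\kappa_n(\tau^*(C))=\kappa_n(C)$ for every permutation $\tau$ of $I^n$; A5 $\kappa_n(\sigma^*(C))=\kappa_n(C)$; A6 $\sum_{\rho\in\mathcal R_n}\kappa_n(\rho^*(C))=0$; A7 $r_n\kappa_n(C)=\kappa_{n+1}(E)+\kappa_{n+1}(\sigma_1^*(E))$ whenever $E$ is an $(n+1)$-copula with $C(x_1,\dots,x_n)=E(1,x_1,\dots,x_n)$. One extends to $n=0,1$ by $\kappa_0=\kappa_1=0$;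 $r_0,r_1$ may be any real numbers. Set notation. $R+T$ denotes $R\cup T$ with the understanding that $R\cap T=\emptyset$ (similarly for three sets). $S(k)$ is the set of subsets of $S$ of cardinality $k$ (empty if $k>\mathrm{card}(S)$). For $S,T\subseteq\overline n$, $t=\mathrm{card}(T)$, $0\le j\le n$, $$\mathfrak A_j^S(C_T)=r_{n-t}r_{n-t-1}\cdots r_j\sum_{Q\in(S\setminus T)(n-j-t)}\kappa_j(C_{Q+T}),$$ taken to be $0$ if $(S\setminus T)(n-j-t)=\emptyset$. The product has the single factor $r_{n-t}$ when $j=n-t$. *)

theory Defs
  imports "HOL-Probability.Probability"
begin

text \<open>
  A point of \<open>I\<^sup>n\<close> is a function on the indices \<open>1, \<dots>, n\<close> that is \<open>undefined\<close> elsewhere.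
  Likewise a function on \<open>I\<^sup>n\<close> is \<open>undefined\<close> outside \<open>I\<^sup>n\<close>, so that
  HOL equality of such functions is equality on \<open>I\<^sup>n\<close>.
\<close>

type_synonym point = "nat \<Rightarrow> real"

definition cube :: "nat \<Rightarrow> point set" where
  "cube n = {1..n} \<rightarrow>\<^sub>E {0..1}"

definition origin_box :: "nat \<Rightarrow> point \<Rightarrow> point set" where
  "origin_box n x = (\<Pi>\<^sub>E i\<in>{1..n}. {0..x i})"


section \<open>Copulas\<close>

text \<open>
  The Borel sets of \<open>I\<^sup>n\<close> form the product \<open>\<sigma>\<close>-algebra of the Borel sets of \<open>I\<close>, as \<open>I\<close> is
  second countable.
\<close>

definition represents_copula :: "nat \<Rightarrow> (point \<Rightarrow> real) \<Rightarrow> point measure \<Rightarrow> bool" where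
  "represents_copula n C \<mu> \<longleftrightarrow>
     prob_space \<mu> \<and>
     sets \<mu> = sets (\<Pi>\<^sub>M i\<in>{1..n}. restrict_space borel {0..1::real}) \<and>
     (\<forall>i\<in>{1..n}. distr \<mu> (restrict_space borel {0..1}) (\<lambda>x. x i) = restrict_space lborel {0..1}) \<and>
     (\<forall>x\<in>cube n. measure \<mu> (origin_box n x) = C x)"

text \<open>For \<open>n = 0\<close> this yields exactly the constant \<open>1\<close> on the one-point space \<open>I\<^sup>0\<close>.\<close>

definition copula :: "nat \<Rightarrow> (point \<Rightarrow> real) \<Rightarrow> bool" where
  "copula n C \<longleftrightarrow> C \<in> cube n \<rightarrow>\<^sub>E {0..1} \<and> (\<exists>\<mu>. represents_copula n C \<mu>)"

text \<open>
  The measure is unique: the boxes \<open>[0,x]\<close> are stable under intersection and generate the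
  Borel sets.
\<close>

definition copula_measure :: "nat \<Rightarrow> (point \<Rightarrow> real) \<Rightarrow> point measure" where
  "copula_measure n C = (THE \<mu>. represents_copula n C \<mu>)"

definition min_copula :: "nat \<Rightarrow> point \<Rightarrow> real" where
  "min_copula n = (\<lambda>x\<in>cube n. Min (x ` {1..n}))"

definition product_copula :: "nat \<Rightarrow> point \<Rightarrow> real" where
  "product_copula n = (\<lambda>x\<in>cube n. \<Prod>i\<in>{1..n}. x i)"


section \<open>Symmetries\<close>

definition coord_permutation :: "nat \<Rightarrow> (nat \<Rightarrow> nat) \<Rightarrow> point \<Rightarrow> point" where
  "coord_permutation n p x = (\<lambda>i\<in>{1..n}. x (p i))"

definition elem_reflection :: "nat \<Rightarrow> point \<Rightarrow> point" where
  "elem_reflection i x = x(i := 1 - x i)"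

text \<open>
  Reflections are taken as maps on all of \<open>point\<close>. Each of them maps \<open>cube n\<close> to itself, and two
  of them that agree on \<open>cube n\<close> are equal, so a sum over \<open>reflections n\<close> counts every
  reflection of \<open>I\<^sup>n\<close> exactly once.
\<close>

inductive_set reflections :: "nat \<Rightarrow> (point \<Rightarrow> point) set" for n where
  identity: "id \<in> reflections n"
| compose: "\<rho> \<in> reflections n \<Longrightarrow> i \<in> {1..n} \<Longrightarrow> elem_reflection i \<circ> \<rho> \<in> reflections n"

text \<open>\<open>\<sigma> = \<sigma>\<^sub>1 \<circ> \<dots> \<circ> \<sigma>\<^sub>n\<close>\<close>

definition full_reflection :: "nat \<Rightarrow> point \<Rightarrow> point" where
  "full_reflection n x = foldr elem_reflection [1..<Suc n] x"

definition transform :: "nat \<Rightarrow> (point \<Rightarrow> point) \<Rightarrow> (point \<Rightarrow> real) \<Rightarrow> point \<Rightarrow> real" where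
  "transform n \<xi> C = (\<lambda>x\<in>cube n. measure (copula_measure n C) (\<xi> ` origin_box n x))"

definition concordance_le :: "nat \<Rightarrow> (point \<Rightarrow> real) \<Rightarrow> (point \<Rightarrow> real) \<Rightarrow> bool" where
  "concordance_le n A B \<longleftrightarrow>
     (\<forall>x\<in>cube n. A x \<le> B x) \<and>
     (\<forall>x\<in>cube n. transform n (full_reflection n) A x \<le> transform n (full_reflection n) B x)"


section \<open>Marginals\<close>

definition marginal :: "nat \<Rightarrow> (point \<Rightarrow> real) \<Rightarrow> nat set \<Rightarrow> point \<Rightarrow> real" where
  "marginal n C T = (\<lambda>x\<in>cube n. C (\<lambda>i\<in>{1..n}. if i \<in> T then 1 else x i))"

text \<open>
  A remaining variable \<open>x\<^sub>i\<close> becomes variable number \<open>k\<close> of the proper copula, where \<open>i\<close> is the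
  \<open>k\<close>-th smallest element of \<open>{1..n} - T\<close>. The value \<open>1\<close> at the indices in \<open>T\<close> is arbitrary,
  since \<open>marginal n C T\<close> does not depend on those variables.
\<close>

definition proper_copula :: "nat \<Rightarrow> (point \<Rightarrow> real) \<Rightarrow> nat set \<Rightarrow> point \<Rightarrow> real" where
  "proper_copula n C T =
     (\<lambda>y\<in>cube (n - card T).
        marginal n C T (\<lambda>i\<in>{1..n}. if i \<in> T then 1 else y (card {k \<in> {1..n} - T. k \<le> i})))"


section \<open>Measures of concordance\<close>

text \<open>The values of \<open>\<kappa> n\<close> and \<open>r n\<close> for \<open>n < 2\<close> are unconstrained.\<close>

locale measure_of_concordance =
  fixes \<kappa> :: "nat \<Rightarrow> (point \<Rightarrow> real) \<Rightarrow> real"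
    and r :: "nat \<Rightarrow> real"
  assumes normalized_min: "2 \<le> n \<Longrightarrow> \<kappa> n (min_copula n) = 1"
    and normalized_product: "2 \<le> n \<Longrightarrow> \<kappa> n (product_copula n) = 0"
    and monotone: "2 \<le> n \<Longrightarrow> copula n A \<Longrightarrow> copula n B \<Longrightarrow> concordance_le n A B
      \<Longrightarrow> \<kappa> n A \<le> \<kappa> n B"
    and continuous: "2 \<le> n \<Longrightarrow> (\<And>m. copula n (D m)) \<Longrightarrow> copula n C
      \<Longrightarrow> uniform_limit (cube n) D C sequentially \<Longrightarrow> (\<lambda>m. \<kappa> n (D m)) \<longlonglongrightarrow> \<kappa> n C"
    and permutation_invariant: "2 \<le> n \<Longrightarrow> copula n C \<Longrightarrow> p permutes {1..n}
      \<Longrightarrow> \<kappa> n (transform n (coord_permutation n p) C) = \<kappa> n C"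
    and duality: "2 \<le> n \<Longrightarrow> copula n C \<Longrightarrow> \<kappa> n (transform n (full_reflection n) C) = \<kappa> n C"
    and reflection_symmetry: "2 \<le> n \<Longrightarrow> copula n C
      \<Longrightarrow> (\<Sum>\<rho>\<in>reflections n. \<kappa> n (transform n \<rho> C)) = 0"
    and transition: "2 \<le> n \<Longrightarrow> copula n C \<Longrightarrow> copula (Suc n) E
      \<Longrightarrow> (\<And>x. x \<in> cube n \<Longrightarrow> C x = E (\<lambda>i\<in>{1..Suc n}. if i = 1 then 1 else x (i - 1)))
      \<Longrightarrow> r n * \<kappa> n C = \<kappa> (Suc n) E + \<kappa> (Suc n) (transform (Suc n) (elem_reflection 1) E)"

definition extended :: "(nat \<Rightarrow> (point \<Rightarrow> real) \<Rightarrow> real) \<Rightarrow> nat \<Rightarrow> (point \<Rightarrow> real) \<Rightarrow> real" where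
  "extended \<kappa> n C = (if n < 2 then 0 else \<kappa> n C)"

text \<open>
  \<open>marginal_sum \<kappa> r n C j S T\<close> is \<open>\<AA>\<^sub>j\<^sup>S(C\<^sub>T)\<close>, with \<open>card Q = n - j - card T\<close> written
  additively. Thus the index set is empty, and the sum \<open>0\<close>, if \<open>n - j - card T\<close> is negative.
\<close>

definition marginal_sum ::
  "(nat \<Rightarrow> (point \<Rightarrow> real) \<Rightarrow> real) \<Rightarrow> (nat \<Rightarrow> real) \<Rightarrow> nat \<Rightarrow> (point \<Rightarrow> real) \<Rightarrow> nat \<Rightarrow>
     nat set \<Rightarrow> nat set \<Rightarrow> real" where
  "marginal_sum \<kappa> r n C j S T =
     (\<Prod>i\<in>{j..n - card T}. r i) *
     (\<Sum>Q | Q \<subseteq> S - T \<and> card Q + j + card T = n. extended \<kappa> j (proper_copula n C (Q \<union> T)))"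

end

theory Submission imports Defs begin

text \<open>
  Write \<open>C\<close> as the joint distribution function of uniform variables \<open>X\<^sub>1, \<dots>, X\<^sub>n\<close>, namely the
  coordinates under \<open>\<mu>\<^sub>C\<close>. Permutations, reflections and marginals of \<open>C\<close> then become
  reindexings of the \<open>X\<^sub>i\<close>, replacements of \<open>X\<^sub>i\<close> by \<open>1 - X\<^sub>i\<close>, and omissions of variables. Axioms
  A4 and A7 give \<open>\<kappa>\<^sub>m(\<sigma>\<^sub>i\<^sup>*(E)) = r\<^sub>m\<^sub>-\<^sub>1 \<kappa>\<^sub>m\<^sub>-\<^sub>1(E\<^sub>i) - \<kappa>\<^sub>m(E)\<close> for every coordinate \<open>i\<close>; for \<open>m = 2\<close>
  this is not an instance of A7 and comes from A5 and A6 instead. Reflecting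
  the coordinates in \<open>R\<close> one after another expresses the left-hand side, with \<open>m = n - t\<close>, as
  \<open>(-1)\<^sup>m r\<^sub>m \<kappa>\<^sub>m\<close> of the reflection of \<open>C\<^sub>T\<close> in \<open>R\<close>. The right-hand side is the same with \<open>S\<close> in place
  of \<open>R\<close>, and the two reflections differ by the full reflection, which leaves \<open>\<kappa>\<^sub>m\<close> invariant by A5.
\<close>

section \<open>Uniform random variables and their joint distribution functions\<close>

abbreviation unit_borel :: "real measure" where
  "unit_borel \<equiv> restrict_space borel {0..1}"

text \<open>The target \<open>unit_borel\<close> forces values in [0,1] at every point of the space
  and not only almost everywhere. Measurability is a separate conjunct because \<open>distr\<close>
  is meaningful only for measurable maps.\<close>

definition uniform_rv :: "'a measure \<Rightarrow> ('a \<Rightarrow> real) \<Rightarrow> bool" where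
  "uniform_rv M X \<longleftrightarrow>
     X \<in> M \<rightarrow>\<^sub>M unit_borel \<and> distr M unit_borel X = restrict_space lborel {0..1}"

text \<open>Restricted to \<open>cube m\<close>, so that agreement with a copula on the cube is HOL
  equality.\<close>

definition joint_cdf :: "'a measure \<Rightarrow> nat \<Rightarrow> (nat \<Rightarrow> 'a \<Rightarrow> real) \<Rightarrow> point \<Rightarrow> real" where
  "joint_cdf M m Y = (\<lambda>x\<in>cube m. measure M {\<omega> \<in> space M. \<forall>i\<in>{1..m}. Y i \<omega> \<le> x i})"

definition joint_vector :: "nat \<Rightarrow> (nat \<Rightarrow> 'a \<Rightarrow> real) \<Rightarrow> 'a \<Rightarrow> point" where
  "joint_vector m Y \<omega> = (\<lambda>i\<in>{1..m}. Y i \<omega>)"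

definition flip :: "nat set \<Rightarrow> (nat \<Rightarrow> 'a \<Rightarrow> real) \<Rightarrow> nat \<Rightarrow> 'a \<Rightarrow> real" where
  "flip A Y i \<omega> = (if i \<in> A then 1 - Y i \<omega> else Y i \<omega>)"

text \<open>Acts on all of \<open>point\<close>, as \<open>elem_reflection\<close> does. Every
  composition of elementary reflections is then \<open>reflect A\<close>, with \<open>A\<close> the
  set of coordinates reflected an odd number of times.\<close>

definition reflect :: "nat set \<Rightarrow> point \<Rightarrow> point" where
  "reflect A x i = (if i \<in> A then 1 - x i else x i)"

lemma space_unit_borel [simp]: "space unit_borel = {0..1}"
  by (simp add: space_restrict_space)

lemma space_PiM_unit_borel: "space (Pi\<^sub>M {1..m} (\<lambda>_. unit_borel)) = cube m"
  by (simp add: space_PiM cube_def)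

lemma uniform_rv_range: "uniform_rv M X \<Longrightarrow> \<omega> \<in> space M \<Longrightarrow> 0 \<le> X \<omega> \<and> X \<omega> \<le> 1"
  unfolding uniform_rv_def by (auto dest!: measurable_space)

section \<open>Invariance of the uniform distribution under u -> 1 - u\<close>

lemma measurable_one_minus_unit_borel: "(\<lambda>u. 1 - u) \<in> unit_borel \<rightarrow>\<^sub>M unit_borel"
  by (intro measurable_restrict_space2 measurable_restrict_space1) auto

lemma distr_one_minus_lborel: "distr lborel borel (\<lambda>u. 1 - u) = (lborel :: real measure)"
  using lborel_real_affine[of "-1" 1] by (simp add: density_1)

text \<open>Lebesgue measure on the line is invariant under u -> 1 - u, and this map sends [0,1]
  onto itself, so the invariance passes to the restriction.\<close>

lemma distr_one_minus_unit:
  "distr (restrict_space lborel {0..1}) unit_borel (\<lambda>u. 1 - u) = restrict_space lborel {0..1::real}"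
proof (rule measure_eqI)
  show "sets (distr (restrict_space lborel {0..1}) unit_borel (\<lambda>u. 1 - u)) =
      sets (restrict_space lborel {0..1::real})"
    by (simp add: sets_restrict_space)
next
  fix A assume "A \<in> sets (distr (restrict_space lborel {0..1}) unit_borel (\<lambda>u. 1 - u :: real))"
  then have A: "A \<in> sets unit_borel" by simp
  then have Ab: "A \<in> sets borel" "A \<subseteq> {0..1}"
    by (auto simp: sets_restrict_space_iff)
  have meas: "(\<lambda>u. 1 - u) \<in> restrict_space lborel {0..1::real} \<rightarrow>\<^sub>M unit_borel"
    using measurable_one_minus_unit_borel
    by (simp cong: measurable_cong_sets add: sets_restrict_space)
  have "emeasure (distr (restrict_space lborel {0..1}) unit_borel (\<lambda>u. 1 - u)) A =
      emeasure (restrict_space lborel {0..1}) ((\<lambda>u. 1 - u) -` A \<inter> {0..1})"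
    using A meas by (simp add: emeasure_distr space_restrict_space)
  also have "(\<lambda>u. 1 - u) -` A \<inter> {0..1} = (\<lambda>u. 1 - u) -` A"
    using Ab(2) by force
  also have "emeasure (restrict_space lborel {0..1}) ((\<lambda>u. 1 - u) -` A) =
      emeasure lborel ((\<lambda>u. 1 - u) -` A)"
    using Ab(2) by (subst emeasure_restrict_space) force+
  also have "\<dots> = emeasure (distr lborel borel (\<lambda>u. 1 - u)) A"
    using Ab(1) by (simp add: emeasure_distr)
  also have "\<dots> = emeasure (restrict_space lborel {0..1}) A"
    using Ab by (simp add: distr_one_minus_lborel emeasure_restrict_space)
  finally show "emeasure (distr (restrict_space lborel {0..1}) unit_borel (\<lambda>u. 1 - u)) A =
      emeasure (restrict_space lborel {0..1}) A" .
qed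

lemma uniform_rv_one_minus:
  assumes "uniform_rv M X"
  shows "uniform_rv M (\<lambda>\<omega>. 1 - X \<omega>)"
proof -
  have X: "X \<in> M \<rightarrow>\<^sub>M unit_borel" "distr M unit_borel X = restrict_space lborel {0..1}"
    using assms by (auto simp: uniform_rv_def)
  have "distr M unit_borel (\<lambda>\<omega>. 1 - X \<omega>) = distr (distr M unit_borel X) unit_borel (\<lambda>u. 1 - u)"
    by (subst distr_distr[OF measurable_one_minus_unit_borel X(1)]) (simp add: comp_def)
  also have "\<dots> = restrict_space lborel {0..1}"
    by (simp add: X(2) distr_one_minus_unit)
  finally show ?thesis
    using measurable_compose[OF X(1) measurable_one_minus_unit_borel] by (simp add: uniform_rv_def)
qed

lemma uniform_rv_flip: "uniform_rv M (Y i) \<Longrightarrow> uniform_rv M (flip A Y i)"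
  using uniform_rv_one_minus[of M "Y i"] by (cases "i \<in> A") (simp_all add: flip_def[abs_def])

lemma joint_vector_measurable:
  assumes "\<And>i. i \<in> {1..m} \<Longrightarrow> uniform_rv M (Y i)"
  shows "joint_vector m Y \<in> M \<rightarrow>\<^sub>M Pi\<^sub>M {1..m} (\<lambda>_. unit_borel)"
  unfolding joint_vector_def[abs_def]
  by (rule measurable_restrict) (use assms in \<open>auto simp: uniform_rv_def\<close>)

lemma joint_cdf_cong:
  assumes "\<And>i \<omega>. i \<in> {1..m} \<Longrightarrow> \<omega> \<in> space M \<Longrightarrow> Y i \<omega> = Z i \<omega>"
  shows "joint_cdf M m Y = joint_cdf M m Z"
proof -
  have "{\<omega> \<in> space M. \<forall>i\<in>{1..m}. Y i \<omega> \<le> x i} = {\<omega> \<in> space M. \<forall>i\<in>{1..m}. Z i \<omega> \<le> x i}" for x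
    using assms by auto
  then show ?thesis by (simp add: joint_cdf_def)
qed

section \<open>Uniqueness of the measure of a copula\<close>

text \<open>The trace of \<open>{..a}\<close> on [0,1] is empty, an interval [0,a], or all of [0,1].
  These generators are chosen because their products are the boxes [0,x].\<close>

lemma sets_unit_borel:
  "sets unit_borel = sigma_sets {0..1} {{0..a} | a. a \<in> {0..1}}" (is "_ = sigma_sets _ ?E")
proof
  have "sets unit_borel = (\<inter>) {0..1} ` sigma_sets UNIV (range atMost)"
    by (simp add: sets_restrict_space borel_eq_atMost)
  also have "\<dots> = sigma_sets {0..1} ((\<inter>) {0..1} ` range atMost)"
  proof (rule sigma_sets_Int)
    have "{0..1::real} \<in> sets (sigma UNIV (range atMost))"
      unfolding borel_eq_atMost[symmetric] by simp
    then show "{0..1::real} \<in> sigma_sets UNIV (range atMost)" by simp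
  qed simp
  also have "\<dots> \<subseteq> sigma_sets {0..1} ?E"
  proof (rule sigma_sets_mono, safe)
    fix a :: real
    consider "a < 0" | "0 \<le> a" "a \<le> 1" | "1 < a" by linarith
    then show "{0..1} \<inter> {..a} \<in> sigma_sets {0..1} ?E"
    proof cases
      case 1
      then have "{0..1} \<inter> {..a} = {}" by auto
      then show ?thesis by (simp add: sigma_sets.Empty)
    next
      case 2
      then have "{0..1} \<inter> {..a} = {0..a}" by auto
      then show ?thesis using 2 by (auto intro!: sigma_sets.Basic)
    next
      case 3
      then have "{0..1} \<inter> {..a} = {0..1}" by auto
      then show ?thesis by (simp add: sigma_sets_top)
    qed
  qed
  finally show "sets unit_borel \<subseteq> sigma_sets {0..1} ?E" .
next
  have "?E \<subseteq> sets unit_borel" by (auto simp: sets_restrict_space_iff)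
  then show "sigma_sets {0..1} ?E \<subseteq> sets unit_borel"
    using sets.sigma_sets_subset[of ?E unit_borel] by simp
qed

lemma sets_PiM_unit_borel:
  "sets (Pi\<^sub>M {1..n} (\<lambda>_. unit_borel)) = sigma_sets (cube n) (origin_box n ` cube n)"
proof -
  define E where "E = {{0..a} | a. a \<in> {0..1::real}}"
  \<comment> \<open>\<open>P\<close> has the shape of the generator in
    \<open>sets_PiM_sigma\<close>, with the whole index set as the only block.\<close>
  define P where "P = {{f \<in> {1..n} \<rightarrow>\<^sub>E {0..1}. \<forall>i\<in>j. f i \<in> A i} | A j.
    j \<in> {{1..n}} \<and> A \<in> Pi j (\<lambda>_. E)}"
  have E: "E \<subseteq> Pow {0..1}" by (auto simp: E_def)
  have box: "{f \<in> {1..n} \<rightarrow>\<^sub>E {0..1}. \<forall>i\<in>{1..n}. f i \<in> A i} = Pi\<^sub>E {1..n} A"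
    if "\<And>i. i \<in> {1..n} \<Longrightarrow> A i \<subseteq> {0..1}" for A :: "nat \<Rightarrow> real set"
    using that unfolding PiE_iff set_eq_iff by blast
  have P: "P = origin_box n ` cube n"
  proof
    show "P \<subseteq> origin_box n ` cube n"
    proof
      fix B assume "B \<in> P"
      then obtain A where B: "B = {f \<in> {1..n} \<rightarrow>\<^sub>E {0..1}. \<forall>i\<in>{1..n}. f i \<in> A i}"
        and "\<forall>i\<in>{1..n}. \<exists>a. A i = {0..a} \<and> a \<in> {0..1::real}"
        by (auto simp: P_def E_def Pi_iff)
      then obtain a where a: "\<And>i. i \<in> {1..n} \<Longrightarrow> A i = {0..a i} \<and> a i \<in> {0..1::real}"
        by metis
      have "B = origin_box n (restrict a {1..n})"
        unfolding B origin_box_def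
      proof (subst box)
        show "A i \<subseteq> {0..1}" if "i \<in> {1..n}" for i using a[OF that] by auto
        show "Pi\<^sub>E {1..n} A = (\<Pi>\<^sub>E i\<in>{1..n}. {0..restrict a {1..n} i})"
          by (rule PiE_cong) (simp add: a)
      qed
      moreover have "restrict a {1..n} \<in> cube n" using a by (auto simp: cube_def)
      ultimately show "B \<in> origin_box n ` cube n" by blast
    qed
    show "origin_box n ` cube n \<subseteq> P"
    proof
      fix B assume "B \<in> origin_box n ` cube n"
      then obtain x where x: "x \<in> cube n" and B: "B = origin_box n x" by blast
      have "B = {f \<in> {1..n} \<rightarrow>\<^sub>E {0..1}. \<forall>i\<in>{1..n}. f i \<in> {0..x i}}"
        unfolding B origin_box_def
        by (subst box) (use x in \<open>auto simp: cube_def PiE_iff\<close>)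
      moreover have "(\<lambda>i. {0..x i}) \<in> Pi {1..n} (\<lambda>_. E)"
        using x by (auto simp: E_def cube_def PiE_iff)
      ultimately show "B \<in> P"
        unfolding P_def mem_Collect_eq
        by (intro exI[of _ "\<lambda>i. {0..x i}"] exI[of _ "{1..n}"] conjI) simp_all
    qed
  qed
  have "sets (Pi\<^sub>M {1..n} (\<lambda>_. unit_borel)) = sets (Pi\<^sub>M {1..n} (\<lambda>_. sigma {0..1} E))"
    using E by (intro sets_PiM_cong) (simp_all only: sets_unit_borel sets_measure_of E_def)
  also have "\<dots> = sets (sigma ({1..n} \<rightarrow>\<^sub>E {0..1}) P)"
    unfolding P_def
  proof (rule sets_PiM_sigma)
    have "{0..1} \<in> E" by (auto simp: E_def)
    then show "\<exists>S\<subseteq>E. countable S \<and> {0..1} = \<Union>S" by (intro exI[of _ "{{0..1}}"]) auto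
  qed (use E in auto)
  also have "P \<subseteq> Pow ({1..n} \<rightarrow>\<^sub>E {0..1})" by (auto simp: P_def)
  then have "sets (sigma ({1..n} \<rightarrow>\<^sub>E {0..1}) P) = sigma_sets ({1..n} \<rightarrow>\<^sub>E {0..1}) P"
    by (rule sets_measure_of)
  finally show ?thesis by (simp only: P flip: cube_def)
qed

lemma origin_box_Int:
  "origin_box n x \<inter> origin_box n y = origin_box n (\<lambda>i\<in>{1..n}. min (x i) (y i))"
  by (auto simp: origin_box_def PiE_iff)

text \<open>Makes \<open>copula_measure\<close> computable: any representing measure that is
  exhibited is the one selected by \<open>THE\<close>.\<close>

lemma represents_copula_unique:
  assumes \<mu>: "represents_copula n C \<mu>" and \<nu>: "represents_copula n C \<nu>"
  shows "\<mu> = \<nu>"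
proof -
  interpret \<mu>: prob_space \<mu> using \<mu> by (simp add: represents_copula_def)
  interpret \<nu>: prob_space \<nu> using \<nu> by (simp add: represents_copula_def)
  \<comment> \<open>The cube is itself the box at (1,...,1), so the constant sequence serves as the
    exhaustion by generators of finite measure.\<close>
  have cube_top: "cube n = origin_box n (\<lambda>i\<in>{1..n}. 1)" "(\<lambda>i\<in>{1..n}. 1) \<in> cube n"
    by (auto simp: cube_def origin_box_def PiE_iff)
  show ?thesis
  proof (rule measure_eqI_generator_eq[where E = "origin_box n ` cube n" and \<Omega> = "cube n"
        and A = "\<lambda>_. cube n"])
    show "Int_stable (origin_box n ` cube n)"
    proof (rule Int_stableI_image)
      fix x y assume "x \<in> cube n" "y \<in> cube n"
      then show "\<exists>z\<in>cube n. origin_box n x \<inter> origin_box n y = origin_box n z"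
        by (intro bexI[where x = "\<lambda>i\<in>{1..n}. min (x i) (y i)"])
          (auto simp: origin_box_Int cube_def PiE_iff min_def)
    qed
    show "origin_box n ` cube n \<subseteq> Pow (cube n)"
      by (fastforce simp: cube_def origin_box_def PiE_iff)
    show "sets \<mu> = sigma_sets (cube n) (origin_box n ` cube n)"
      "sets \<nu> = sigma_sets (cube n) (origin_box n ` cube n)"
      using \<mu> \<nu> by (simp_all only: represents_copula_def sets_PiM_unit_borel)
    show "emeasure \<mu> X = emeasure \<nu> X" if "X \<in> origin_box n ` cube n" for X
      using that \<mu> \<nu>
      by (auto simp: represents_copula_def \<mu>.emeasure_eq_measure \<nu>.emeasure_eq_measure)
  qed (use cube_top in auto)
qed

lemma copula_measure_eqI: "represents_copula n C \<mu> \<Longrightarrow> copula_measure n C = \<mu>"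
  unfolding copula_measure_def using represents_copula_unique by blast

section \<open>Copulas of families of random variables\<close>

lemma (in prob_space) represents_joint_cdf:
  assumes Y: "\<And>i. i \<in> {1..m} \<Longrightarrow> uniform_rv M (Y i)"
  shows "represents_copula m (joint_cdf M m Y)
      (distr M (Pi\<^sub>M {1..m} (\<lambda>_. unit_borel)) (joint_vector m Y))"
    (is "represents_copula _ _ ?\<mu>")
proof -
  have V: "joint_vector m Y \<in> M \<rightarrow>\<^sub>M Pi\<^sub>M {1..m} (\<lambda>_. unit_borel)"
    by (rule joint_vector_measurable[OF Y])
  have "prob_space ?\<mu>" by (rule prob_space_distr[OF V])
  moreover have "distr ?\<mu> unit_borel (\<lambda>x. x i) = restrict_space lborel {0..1}" if "i \<in> {1..m}" for i
  proof -
    have "distr ?\<mu> unit_borel (\<lambda>x. x i) = distr M unit_borel ((\<lambda>x. x i) \<circ> joint_vector m Y)"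
      by (rule distr_distr[OF measurable_component_singleton[OF that] V])
    also have "(\<lambda>x. x i) \<circ> joint_vector m Y = Y i"
      using that by (auto simp: joint_vector_def)
    finally show ?thesis using Y[OF that] by (simp add: uniform_rv_def)
  qed
  moreover have "measure ?\<mu> (origin_box m x) = joint_cdf M m Y x" if "x \<in> cube m" for x
  proof -
    have "origin_box m x \<in> sets (Pi\<^sub>M {1..m} (\<lambda>_. unit_borel))"
      unfolding sets_PiM_unit_borel using that by (intro sigma_sets.Basic) auto
    then have "measure ?\<mu> (origin_box m x) = prob (joint_vector m Y -` origin_box m x \<inter> space M)"
      by (rule measure_distr[OF V])
    \<comment> \<open>Box membership also asks for 0 \<le> \<open>Y i \<omega>\<close>, which holds
      because uniform variables take values in [0,1].\<close>
    also have "joint_vector m Y -` origin_box m x \<inter> space M =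
        {\<omega> \<in> space M. \<forall>i\<in>{1..m}. Y i \<omega> \<le> x i}"
      using Y uniform_rv_range by (fastforce simp: joint_vector_def origin_box_def PiE_iff)
    finally show ?thesis using that by (simp add: joint_cdf_def)
  qed
  ultimately show ?thesis by (simp add: represents_copula_def)
qed

lemma (in prob_space) copula_joint_cdf:
  assumes "\<And>i. i \<in> {1..m} \<Longrightarrow> uniform_rv M (Y i)"
  shows "copula m (joint_cdf M m Y)"
  using represents_joint_cdf[of m Y, OF assms] by (auto simp: copula_def joint_cdf_def)

text \<open>\<open>transform\<close> measures the image of [0,x] under \<xi>. On the cube this image
  is the preimage of [0,x] under the inverse \<eta>, so the transformed copula belongs to the vector
  obtained by applying \<eta> to the variables.\<close>

lemma (in prob_space) transform_joint_cdf:
  assumes Y: "\<And>i. i \<in> {1..m} \<Longrightarrow> uniform_rv M (Y i)"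
    and \<eta>: "\<eta> \<in> Pi\<^sub>M {1..m} (\<lambda>_. unit_borel) \<rightarrow>\<^sub>M Pi\<^sub>M {1..m} (\<lambda>_. unit_borel)"
    and \<xi>: "\<And>x. x \<in> cube m \<Longrightarrow> \<xi> x \<in> cube m"
    and inv: "\<And>x. x \<in> cube m \<Longrightarrow> \<xi> (\<eta> x) = x" "\<And>x. x \<in> cube m \<Longrightarrow> \<eta> (\<xi> x) = x"
    and Z: "\<And>\<omega>. \<omega> \<in> space M \<Longrightarrow> joint_vector m Z \<omega> = \<eta> (joint_vector m Y \<omega>)"
  shows "transform m \<xi> (joint_cdf M m Y) = joint_cdf M m Z"
proof -
  let ?P = "Pi\<^sub>M {1..m} (\<lambda>_. unit_borel)"
  have V: "joint_vector m Y \<in> M \<rightarrow>\<^sub>M Pi\<^sub>M {1..m} (\<lambda>_. unit_borel)"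
    by (rule joint_vector_measurable[OF Y])
  have "measure (copula_measure m (joint_cdf M m Y)) (\<xi> ` origin_box m x) =
      prob {\<omega> \<in> space M. \<forall>i\<in>{1..m}. Z i \<omega> \<le> x i}" if x: "x \<in> cube m" for x
  proof -
    have box: "origin_box m x \<in> sets ?P"
      unfolding sets_PiM_unit_borel using x by (intro sigma_sets.Basic) auto
    then have sub: "origin_box m x \<subseteq> cube m"
      using sets.sets_into_space[OF box] by (simp only: space_PiM_unit_borel)
    have im: "\<xi> ` origin_box m x = \<eta> -` origin_box m x \<inter> space ?P"
      unfolding space_PiM_unit_borel
    proof (intro equalityI subsetI)
      fix y assume "y \<in> \<xi> ` origin_box m x"
      then show "y \<in> \<eta> -` origin_box m x \<inter> cube m" using sub \<xi> inv(2) by auto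
    next
      fix y assume y: "y \<in> \<eta> -` origin_box m x \<inter> cube m"
      then have "y = \<xi> (\<eta> y)" using inv(1) by simp
      then show "y \<in> \<xi> ` origin_box m x" using y by blast
    qed
    have "measure (copula_measure m (joint_cdf M m Y)) (\<xi> ` origin_box m x) =
        measure (distr M ?P (joint_vector m Y)) (\<eta> -` origin_box m x \<inter> space ?P)"
      unfolding im
      by (subst copula_measure_eqI) (rule represents_joint_cdf[OF Y] refl | assumption)+
    also have "\<dots> = prob (joint_vector m Y -` (\<eta> -` origin_box m x \<inter> space ?P) \<inter> space M)"
      by (rule measure_distr[OF V measurable_sets[OF \<eta> box]])
    also have "joint_vector m Y -` (\<eta> -` origin_box m x \<inter> space ?P) \<inter> space M =
        {\<omega> \<in> space M. \<forall>i\<in>{1..m}. Z i \<omega> \<le> x i}" (is "?L = ?R")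
    proof (rule set_eqI)
      fix \<omega>
      show "\<omega> \<in> ?L \<longleftrightarrow> \<omega> \<in> ?R"
      proof (cases "\<omega> \<in> space M")
        case True
        then have Vs: "joint_vector m Y \<omega> \<in> space ?P" by (rule measurable_space[OF V])
        \<comment> \<open>The box bounds each \<open>Z i \<omega>\<close> below by 0; this is
          automatic, since \<eta> keeps the vector in the cube.\<close>
        then have "joint_vector m Z \<omega> \<in> cube m"
          using measurable_space[OF \<eta> Vs] Z[OF True] by (simp only: space_PiM_unit_borel)
        then have "\<forall>i\<in>{1..m}. 0 \<le> Z i \<omega>"
          by (auto simp: joint_vector_def cube_def PiE_iff)
        moreover have "\<omega> \<in> ?L \<longleftrightarrow> joint_vector m Z \<omega> \<in> origin_box m x"
          using True Vs Z[OF True] by simp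
        ultimately show ?thesis
          using True by (auto simp: joint_vector_def origin_box_def PiE_iff)
      qed simp
    qed
    finally show ?thesis .
  qed
  then show ?thesis by (auto simp: transform_def joint_cdf_def)
qed

section \<open>Reflections and permutations acting on families of variables\<close>

lemma reflect_cube: "A \<subseteq> {1..m} \<Longrightarrow> x \<in> cube m \<Longrightarrow> reflect A x \<in> cube m"
  by (fastforce simp: cube_def PiE_iff reflect_def extensional_def)

lemma reflect_reflect [simp]: "reflect A (reflect A x) = x"
  by (auto simp: reflect_def)

lemma reflect_measurable:
  assumes A: "A \<subseteq> {1..m}"
  shows "reflect A \<in> Pi\<^sub>M {1..m} (\<lambda>_. unit_borel) \<rightarrow>\<^sub>M Pi\<^sub>M {1..m} (\<lambda>_. unit_borel)"
proof -
  let ?P = "Pi\<^sub>M {1..m} (\<lambda>_. unit_borel)"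
  have "(\<lambda>x. \<lambda>i\<in>{1..m}. if i \<in> A then 1 - x i else x i) \<in> ?P \<rightarrow>\<^sub>M ?P"
  proof (rule measurable_restrict)
    fix i assume i: "i \<in> {1..m}"
    have "(\<lambda>x. x i) \<in> ?P \<rightarrow>\<^sub>M unit_borel" by (rule measurable_component_singleton[OF i])
    from this measurable_compose[OF this measurable_one_minus_unit_borel]
    show "(\<lambda>x. if i \<in> A then 1 - x i else x i) \<in> ?P \<rightarrow>\<^sub>M unit_borel"
      by (cases "i \<in> A") auto
  qed
  moreover have "(\<lambda>i\<in>{1..m}. if i \<in> A then 1 - x i else x i) = reflect A x" if "x \<in> space ?P" for x
    using that A
    by (auto simp: space_PiM cube_def PiE_iff extensional_def reflect_def fun_eq_iff)
  ultimately show ?thesis by (rule measurable_cong[THEN iffD1, rotated])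
qed

lemma (in prob_space) transform_reflect_joint_cdf:
  assumes Y: "\<And>i. i \<in> {1..m} \<Longrightarrow> uniform_rv M (Y i)" and A: "A \<subseteq> {1..m}"
  shows "transform m (reflect A) (joint_cdf M m Y) = joint_cdf M m (flip A Y)"
  using A by (intro transform_joint_cdf[OF Y reflect_measurable[OF A] reflect_cube[OF A]])
    (auto simp: joint_vector_def flip_def reflect_def fun_eq_iff)

text \<open>The inverse appears because variables move by the inverse of the point map, and
  \<open>coord_permutation m p\<close> is inverse to \<open>coord_permutation m (inv p)\<close> on
  the cube.\<close>

lemma (in prob_space) transform_permutation_joint_cdf:
  assumes Y: "\<And>i. i \<in> {1..m} \<Longrightarrow> uniform_rv M (Y i)" and p: "p permutes {1..m}"
  shows "transform m (coord_permutation m (inv p)) (joint_cdf M m Y) = joint_cdf M m (\<lambda>i. Y (p i))"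
proof (rule transform_joint_cdf[OF Y])
  let ?P = "Pi\<^sub>M {1..m} (\<lambda>_. unit_borel)"
  note [simp] = permutes_in_image[OF p, simplified] permutes_in_image[OF permutes_inv[OF p], simplified]
    permutes_inverses[OF p]
  show "coord_permutation m p \<in> ?P \<rightarrow>\<^sub>M ?P"
    unfolding coord_permutation_def[abs_def]
    by (rule measurable_restrict) (rule measurable_component_singleton, simp)
  show "coord_permutation m (inv p) x \<in> cube m" if "x \<in> cube m" for x
    using that by (auto simp: coord_permutation_def cube_def PiE_iff)
  show "coord_permutation m (inv p) (coord_permutation m p x) = x"
    "coord_permutation m p (coord_permutation m (inv p) x) = x" if "x \<in> cube m" for x
    using that by (auto simp: coord_permutation_def cube_def PiE_iff extensional_def fun_eq_iff)
  show "joint_vector m (\<lambda>i. Y (p i)) \<omega> = coord_permutation m p (joint_vector m Y \<omega>)" for \<omega>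
    by (auto simp: joint_vector_def coord_permutation_def)
qed

lemma elem_reflection_eq_reflect: "elem_reflection i = reflect {i}"
  by (auto simp: elem_reflection_def reflect_def fun_eq_iff)

lemma reflect_comp_disjoint: "A \<inter> B = {} \<Longrightarrow> reflect A (reflect B x) = reflect (A \<union> B) x"
  by (auto simp: reflect_def fun_eq_iff)

lemma foldr_elem_reflection: "distinct xs \<Longrightarrow> foldr elem_reflection xs x = reflect (set xs) x"
  by (induction xs)
    (auto simp: elem_reflection_eq_reflect reflect_comp_disjoint, simp add: reflect_def fun_eq_iff)

lemma full_reflection_eq_reflect: "full_reflection n = reflect {1..n}"
  by (rule ext) (simp add: full_reflection_def foldr_elem_reflection atLeastLessThanSuc_atLeastAtMost del: upt_Suc)

lemma id_eq_reflect: "id = reflect {}"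
  by (auto simp: reflect_def fun_eq_iff)

text \<open>Lists the four terms of the sum in A6 for dimension 2, where A7 gives no
  relation.\<close>

lemma reflections_2: "reflections 2 = reflect ` {{}, {1}, {2}, {1, 2}}"
proof
  \<comment> \<open>Composing with \<open>elem_reflection i\<close> toggles the membership of
    \<open>i\<close> in the set of reflected coordinates.\<close>
  have step: "elem_reflection i (reflect A x) = reflect (if i \<in> A then A - {i} else insert i A) x" for i A x
    by (auto simp: elem_reflection_def reflect_def fun_eq_iff)
  show "reflections 2 \<subseteq> reflect ` {{}, {1}, {2}, {1, 2}}"
  proof
    fix \<rho> assume "\<rho> \<in> reflections 2"
    then show "\<rho> \<in> reflect ` {{}, {1}, {2}, {1, 2}}"
    proof induction
      case identity
      then show ?case by (simp add: id_eq_reflect)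
    next
      case (compose \<rho> i)
      then obtain A where A: "\<rho> = reflect A" "A \<in> {{}, {1}, {2}, {1, 2}}" by blast
      have "elem_reflection i \<circ> \<rho> = reflect (if i \<in> A then A - {i} else insert i A)"
        by (rule ext) (simp add: A(1) step)
      moreover have "i = 1 \<or> i = 2" using compose.hyps by auto
      then have "(if i \<in> A then A - {i} else insert i A) \<in> {{}, {1}, {2}, {1, 2}}"
        using A(2) by auto
      ultimately show ?case by blast
    qed
  qed
  have e: "reflect {} \<in> reflections 2"
    using reflections.identity by (simp add: id_eq_reflect)
  have "elem_reflection 1 \<circ> reflect {} \<in> reflections 2"
    "elem_reflection 2 \<circ> reflect {} \<in> reflections 2"
    by (auto intro: reflections.compose e)
  then have s: "reflect {1} \<in> reflections 2" "reflect {2} \<in> reflections 2"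
    by (simp_all add: comp_def step)
  have "elem_reflection 1 \<circ> reflect {2} \<in> reflections 2"
    by (rule reflections.compose[OF s(2)]) simp
  then have "reflect {1, 2} \<in> reflections 2"
    by (simp add: comp_def step)
  with e s show "reflect ` {{}, {1}, {2}, {1, 2}} \<subseteq> reflections 2" by simp
qed

text \<open>\<open>reflect A\<close> sends the origin to the indicator function of \<open>A\<close>.
  Injectivity allows the sum in A6 to be reindexed by sets of coordinates.\<close>

lemma inj_reflect: "inj reflect"
proof (rule injI)
  fix A B :: "nat set" assume "reflect A = reflect B"
  then have eq: "reflect A (\<lambda>_. 0) i = reflect B (\<lambda>_. 0) i" for i by simp
  have "i \<in> A \<longleftrightarrow> i \<in> B" for i
    using eq[of i] by (simp add: reflect_def split: if_splits)
  then show "A = B" by blast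
qed

section \<open>Concordance of families of uniform variables\<close>

text \<open>An arbitrary numbering of a finite set; A4 makes the choice immaterial, see
  \<open>conc_eq\<close>.\<close>

definition enumeration :: "nat set \<Rightarrow> nat \<Rightarrow> nat" where
  "enumeration V = (SOME g. bij_betw g {1..card V} V)"

lemma bij_betw_enumeration: "finite V \<Longrightarrow> bij_betw (enumeration V) {1..card V} V"
  unfolding enumeration_def by (rule someI_ex[OF ex_bij_betw_nat_finite_1])

locale uniform_concordance = measure_of_concordance \<kappa> r + prob_space M
  for \<kappa> :: "nat \<Rightarrow> (point \<Rightarrow> real) \<Rightarrow> real" and r :: "nat \<Rightarrow> real" and M :: "'a measure"
begin

section \<open>Axioms A4 to A7 in terms of uniform variables\<close>

lemma extended_permute:
  assumes Y: "\<And>i. i \<in> {1..m} \<Longrightarrow> uniform_rv M (Y i)" and p: "p permutes {1..m}"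
  shows "extended \<kappa> m (joint_cdf M m (\<lambda>i. Y (p i))) = extended \<kappa> m (joint_cdf M m Y)"
proof -
  have "copula m (joint_cdf M m Y)" by (rule copula_joint_cdf) (rule Y)
  moreover have "transform m (coord_permutation m (inv p)) (joint_cdf M m Y) = joint_cdf M m (\<lambda>i. Y (p i))"
    by (rule transform_permutation_joint_cdf[OF _ p]) (rule Y)
  ultimately show ?thesis
    using permutation_invariant[OF _ _ permutes_inv[OF p], of "joint_cdf M m Y"]
    by (simp add: extended_def)
qed

lemma extended_flip_all:
  assumes Y: "\<And>i. i \<in> {1..m} \<Longrightarrow> uniform_rv M (Y i)"
  shows "extended \<kappa> m (joint_cdf M m (flip {1..m} Y)) = extended \<kappa> m (joint_cdf M m Y)"
proof -
  have "copula m (joint_cdf M m Y)" by (rule copula_joint_cdf) (rule Y)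
  moreover have "transform m (full_reflection m) (joint_cdf M m Y) = joint_cdf M m (flip {1..m} Y)"
    unfolding full_reflection_eq_reflect
    by (rule transform_reflect_joint_cdf[OF _ order_refl]) (rule Y)
  ultimately show ?thesis
    using duality[of m "joint_cdf M m Y"] by (simp add: extended_def)
qed

text \<open>Replaces A7 between dimensions 1 and 2. By A5 the four terms of A6 agree in pairs, {}
  with {1,2} and {1} with {2}, so half of that sum is the claim.\<close>

lemma bivariate_reflection:
  assumes Y: "\<And>i. i \<in> {1..2} \<Longrightarrow> uniform_rv M (Y i)"
  shows "\<kappa> 2 (joint_cdf M 2 Y) + \<kappa> 2 (joint_cdf M 2 (flip {1} Y)) = 0"
proof -
  let ?k = "\<lambda>A. \<kappa> 2 (joint_cdf M 2 (flip A Y))"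
  have t: "transform 2 (reflect A) (joint_cdf M 2 Y) = joint_cdf M 2 (flip A Y)"
    if "A \<in> {{}, {1}, {2}, {1, 2}}" for A
    by (rule transform_reflect_joint_cdf[OF Y]) (use that in auto)
  have "0 = (\<Sum>\<rho>\<in>reflect ` {{}, {1}, {2}, {1, 2}}. \<kappa> 2 (transform 2 \<rho> (joint_cdf M 2 Y)))"
    using reflection_symmetry[OF order_refl copula_joint_cdf[OF Y]] by (simp only: reflections_2)
  also have "\<dots> = (\<Sum>A\<in>{{}, {1}, {2}, {1, 2}}. \<kappa> 2 (transform 2 (reflect A) (joint_cdf M 2 Y)))"
    by (subst sum.reindex[OF inj_on_subset[OF inj_reflect subset_UNIV]]) (simp only: comp_def)
  also have "\<dots> = (\<Sum>A\<in>{{}, {1}, {2}, {1, 2}}. ?k A)"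
    by (rule sum.cong) (simp_all only: t)
  also have "\<dots> = ?k {} + ?k {1} + ?k {2} + ?k {1, 2}"
    by (simp add: doubleton_eq_iff)
  also have "?k {} = \<kappa> 2 (joint_cdf M 2 Y)" by (simp add: flip_def cong: joint_cdf_cong)
  also have "?k {1, 2} = \<kappa> 2 (joint_cdf M 2 Y)"
  proof -
    have "{1..2} = {1, 2::nat}" by auto
    then show ?thesis using extended_flip_all[of 2 Y, OF Y] by (simp add: extended_def)
  qed
  also have "?k {2} = ?k {1}"
  proof -
    \<comment> \<open>Reflecting coordinate 1 and then both coordinates reflects just coordinate
      2.\<close>
    have "joint_cdf M 2 (flip {2} Y) = joint_cdf M 2 (flip {1..2} (flip {1} Y))"
      by (rule joint_cdf_cong) (auto simp: flip_def)
    then show ?thesis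
      using extended_flip_all[of 2 "flip {1} Y", OF uniform_rv_flip[OF Y]] by (simp add: extended_def)
  qed
  finally show ?thesis by simp
qed

text \<open>Extends A7 to all dimensions. For \<open>m = 0\<close> every term vanishes by the
  convention in \<open>extended\<close>; for \<open>m = 1\<close> the left side vanishes and
  \<open>bivariate_reflection\<close> applies.\<close>

lemma extended_transition:
  assumes Y: "\<And>i. i \<in> {1..Suc m} \<Longrightarrow> uniform_rv M (Y i)"
  shows "r m * extended \<kappa> m (joint_cdf M m (\<lambda>i. Y (Suc i))) =
    extended \<kappa> (Suc m) (joint_cdf M (Suc m) Y) + extended \<kappa> (Suc m) (joint_cdf M (Suc m) (flip {1} Y))"
proof -
  consider "m = 0" | "m = 1" | "2 \<le> m" by linarith
  then show ?thesis
  proof cases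
    case 1
    then show ?thesis by (simp add: extended_def)
  next
    case 2
    then show ?thesis using bivariate_reflection[of Y] Y by (simp add: extended_def numeral_2_eq_2)
  next
    case 3
    have Y': "uniform_rv M (Y (Suc i))" if "i \<in> {1..m}" for i
      using Y that by simp
    \<comment> \<open>Setting the first argument to 1 drops the condition on \<open>Y 1\<close>,
      whose values never exceed 1; the other indices shift by one.\<close>
    have "joint_cdf M m (\<lambda>i. Y (Suc i)) x =
        joint_cdf M (Suc m) Y (\<lambda>i\<in>{1..Suc m}. if i = 1 then 1 else x (i - 1))"
      if x: "x \<in> cube m" for x
    proof -
      let ?z = "\<lambda>i\<in>{1..Suc m}. if i = 1 then 1 else x (i - 1)"
      have "?z \<in> cube (Suc m)"
        using x by (force simp: cube_def PiE_iff)
      moreover have "(\<forall>i\<in>{1..m}. Y (Suc i) \<omega> \<le> x i) \<longleftrightarrow> (\<forall>i\<in>{1..Suc m}. Y i \<omega> \<le> ?z i)"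
        if \<omega>: "\<omega> \<in> space M" for \<omega>
      proof
        assume l: "\<forall>i\<in>{1..m}. Y (Suc i) \<omega> \<le> x i"
        show "\<forall>i\<in>{1..Suc m}. Y i \<omega> \<le> ?z i"
        proof
          fix i assume i: "i \<in> {1..Suc m}"
          show "Y i \<omega> \<le> ?z i"
          proof (cases "i = 1")
            case True
            then show ?thesis using uniform_rv_range[OF Y[OF i] \<omega>] by simp
          next
            case False
            then have "i - 1 \<in> {1..m}" "Suc (i - 1) = i" using i by auto
            then show ?thesis using l[rule_format, of "i - 1"] i False by simp
          qed
        qed
      next
        assume box: "\<forall>i\<in>{1..Suc m}. Y i \<omega> \<le> ?z i"
        show "\<forall>i\<in>{1..m}. Y (Suc i) \<omega> \<le> x i"
        proof
          fix i assume "i \<in> {1..m}"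
          then show "Y (Suc i) \<omega> \<le> x i" using box[rule_format, of "Suc i"] by simp
        qed
      qed
      then have "{\<omega> \<in> space M. \<forall>i\<in>{1..m}. Y (Suc i) \<omega> \<le> x i} =
          {\<omega> \<in> space M. \<forall>i\<in>{1..Suc m}. Y i \<omega> \<le> ?z i}"
        by blast
      ultimately show ?thesis using x by (simp only: joint_cdf_def restrict_apply' if_True)
    qed
    from transition[OF 3 copula_joint_cdf[OF Y'] copula_joint_cdf[OF Y] this]
    show ?thesis
      using 3 transform_reflect_joint_cdf[of "Suc m" Y "{1}", OF Y]
      by (simp add: extended_def elem_reflection_eq_reflect)
  qed
qed

text \<open>The extended \<kappa>-value of the subfamily indexed by \<open>V\<close>. Indexing by
  sets turns the omission of a variable into \<open>V - {a}\<close>, free of renumbering.\<close>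

definition conc :: "nat set \<Rightarrow> (nat \<Rightarrow> 'a \<Rightarrow> real) \<Rightarrow> real" where
  "conc V Y = extended \<kappa> (card V) (joint_cdf M (card V) (\<lambda>i. Y (enumeration V i)))"

text \<open>Two numberings of \<open>V\<close> differ by a permutation of
  \<open>{1..card V}\<close>, under which \<kappa> is invariant by A4.\<close>

lemma conc_eq:
  assumes V: "finite V" and Y: "\<And>i. i \<in> V \<Longrightarrow> uniform_rv M (Y i)"
    and g: "bij_betw g {1..card V} V"
  shows "conc V Y = extended \<kappa> (card V) (joint_cdf M (card V) (\<lambda>i. Y (g i)))"
proof -
  let ?I = "{1..card V}"
  \<comment> \<open>\<open>p\<close> satisfies \<open>g (p i) = enumeration V i\<close> on
    \<open>?I\<close> and is the identity elsewhere, as \<open>permutes\<close> demands.\<close>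
  define p where "p i = (if i \<in> ?I then inv_into ?I g (enumeration V i) else i)" for i
  have "bij_betw (inv_into ?I g \<circ> enumeration V) ?I ?I"
    using bij_betw_enumeration[OF V] bij_betw_inv_into[OF g] by (rule bij_betw_trans)
  then have "bij_betw p ?I ?I"
    by (rule bij_betw_cong[THEN iffD1, rotated]) (simp add: p_def)
  then have p: "p permutes ?I"
    by (rule bij_imp_permutes) (auto simp: p_def)
  have gp: "g (p i) = enumeration V i" if "i \<in> ?I" for i
    using that bij_betw_inv_into_right[OF g] bij_betwE[OF bij_betw_enumeration[OF V]]
    by (simp add: p_def)
  have "joint_cdf M (card V) (\<lambda>i. Y (enumeration V i)) = joint_cdf M (card V) (\<lambda>i. Y (g (p i)))"
    by (rule joint_cdf_cong) (simp only: gp)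
  then have "conc V Y = extended \<kappa> (card V) (joint_cdf M (card V) (\<lambda>i. Y (g (p i))))"
    by (simp only: conc_def)
  also have "\<dots> = extended \<kappa> (card V) (joint_cdf M (card V) (\<lambda>i. Y (g i)))"
    by (rule extended_permute[where Y = "\<lambda>i. Y (g i)"]) (use Y bij_betwE[OF g] p in auto)
  finally show ?thesis .
qed

lemma conc_cong:
  assumes "finite V" "\<And>i \<omega>. i \<in> V \<Longrightarrow> \<omega> \<in> space M \<Longrightarrow> Y i \<omega> = Z i \<omega>"
  shows "conc V Y = conc V Z"
proof -
  have "joint_cdf M (card V) (\<lambda>i. Y (enumeration V i)) = joint_cdf M (card V) (\<lambda>i. Z (enumeration V i))"
    using assms bij_betwE[OF bij_betw_enumeration] by (intro joint_cdf_cong) blast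
  then show ?thesis by (simp add: conc_def)
qed

lemma conc_flip_all:
  assumes V: "finite V" and Y: "\<And>i. i \<in> V \<Longrightarrow> uniform_rv M (Y i)"
  shows "conc V (flip V Y) = conc V Y"
proof -
  have e: "enumeration V i \<in> V" if "i \<in> {1..card V}" for i
    using bij_betwE[OF bij_betw_enumeration[OF V]] that by blast
  have "joint_cdf M (card V) (\<lambda>i. flip V Y (enumeration V i)) =
      joint_cdf M (card V) (flip {1..card V} (\<lambda>i. Y (enumeration V i)))"
    by (rule joint_cdf_cong) (use e in \<open>auto simp: flip_def\<close>)
  then show ?thesis
    unfolding conc_def using extended_flip_all[of "card V" "\<lambda>i. Y (enumeration V i)"] Y e by simp
qed

text \<open>A7 concerns the first coordinate only; by \<open>conc_eq\<close> the set
  \<open>V\<close> may be numbered with \<open>a\<close> first.\<close>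

lemma conc_flip_single:
  assumes V: "finite V" and Y: "\<And>i. i \<in> V \<Longrightarrow> uniform_rv M (Y i)" and a: "a \<in> V"
  shows "conc V (flip {a} Y) = r (card V - 1) * conc (V - {a}) Y - conc V Y"
proof -
  obtain m where m: "card V = Suc m" using V a by (cases "card V") auto
  then have m': "card (V - {a}) = m" using a by simp
  \<comment> \<open>With the chosen enumeration of \<open>V - {a}\<close> in the later positions,
    \<open>conc (V - {a}) Y\<close> unfolds to the lower-dimensional term of
    \<open>extended_transition\<close> without a further permutation.\<close>
  define h where "h = enumeration (V - {a})"
  have h: "bij_betw h {1..m} (V - {a})"
    using bij_betw_enumeration[of "V - {a}"] V by (simp add: h_def m')
  define g where "g i = (if i = 1 then a else h (i - 1))" for i
  have g: "bij_betw g {1..card V} V"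
  proof -
    have "bij_betw (\<lambda>i. i - 1) {2..Suc m} {1..m}"
      by (rule bij_betw_byWitness[where f' = Suc]) auto
    then have "bij_betw (h \<circ> (\<lambda>i. i - 1)) {2..Suc m} (V - {a})"
      using h by (rule bij_betw_trans)
    then have "bij_betw g {2..Suc m} (V - {a})"
      by (rule bij_betw_cong[THEN iffD1, rotated]) (auto simp: g_def)
    then have "bij_betw g (insert 1 {2..Suc m}) (insert (g 1) (V - {a}))"
      by (subst notIn_Un_bij_betw3[symmetric, simplified]) (auto simp: g_def)
    moreover have "insert 1 {2..Suc m} = {1..card V}" "insert (g 1) (V - {a}) = V"
      using a by (auto simp: m g_def)
    ultimately show ?thesis by simp
  qed
  have Yg: "uniform_rv M (Y (g i))" if "i \<in> {1..Suc m}" for i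
    using Y bij_betwE[OF g] that m by metis
  have "joint_cdf M m (\<lambda>i. Y (g (Suc i))) = joint_cdf M m (\<lambda>i. Y (h i))"
    by (rule joint_cdf_cong) (auto simp: g_def)
  then have c1: "conc (V - {a}) Y = extended \<kappa> m (joint_cdf M m (\<lambda>i. Y (g (Suc i))))"
    by (simp add: conc_def m' h_def)
  \<comment> \<open>By injectivity of \<open>g\<close>, reflecting the variable \<open>a\<close>
    means reflecting position 1.\<close>
  have ga: "g i = a \<longleftrightarrow> i = 1" if "i \<in> {1..Suc m}" for i
  proof -
    have "1 \<in> {1..Suc m}" by simp
    then have "g i = g 1 \<longleftrightarrow> i = 1"
      using that inj_on_eq_iff[OF bij_betw_imp_inj_on[OF g]] unfolding m by blast
    then show ?thesis by (simp only: g_def[of 1] if_True refl)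
  qed
  have "joint_cdf M (Suc m) (flip {1} (\<lambda>i. Y (g i))) = joint_cdf M (Suc m) (\<lambda>i. flip {a} Y (g i))"
    by (rule joint_cdf_cong) (simp only: flip_def singleton_iff ga)
  moreover have "conc V (flip {a} Y) = extended \<kappa> (Suc m) (joint_cdf M (Suc m) (\<lambda>i. flip {a} Y (g i)))"
    unfolding m[symmetric] by (rule conc_eq[OF V _ g]) (rule uniform_rv_flip[OF Y])
  ultimately have c2: "conc V (flip {a} Y) = extended \<kappa> (Suc m) (joint_cdf M (Suc m) (flip {1} (\<lambda>i. Y (g i))))"
    by (simp only:)
  have c3: "conc V Y = extended \<kappa> (Suc m) (joint_cdf M (Suc m) (\<lambda>i. Y (g i)))"
    unfolding m[symmetric] by (rule conc_eq[OF V Y g])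
  have "r m * extended \<kappa> m (joint_cdf M m (\<lambda>i. Y (g (Suc i)))) =
      extended \<kappa> (Suc m) (joint_cdf M (Suc m) (\<lambda>i. Y (g i))) +
      extended \<kappa> (Suc m) (joint_cdf M (Suc m) (flip {1} (\<lambda>i. Y (g i))))"
    by (rule extended_transition) (rule Yg)
  then show ?thesis unfolding c1 c2 c3 m by simp
qed

text \<open>Iterates \<open>conc_flip_single\<close>. \<open>Q\<close> collects the elements of
  \<open>A\<close> for which the marginal term is taken: each lowers the dimension by one and
  contributes a factor of \<open>r\<close>, while each element of \<open>A - Q\<close> contributes a
  sign -1.\<close>

lemma conc_flip:
  assumes "finite V" "A \<subseteq> V" "\<And>i. i \<in> V \<Longrightarrow> uniform_rv M (Y i)"
  shows "conc V (flip A Y) = (\<Sum>Q\<in>Pow A. (-1) ^ (card A + card Q) *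
    (\<Prod>k\<in>{card V - card Q..<card V}. r k) * conc (V - Q) Y)"
proof -
  have "finite A" using assms finite_subset by blast
  then show ?thesis using assms
  \<comment> \<open>The induction hypothesis is applied both to \<open>V\<close> and to
    \<open>V - {a}\<close>.\<close>
  proof (induction A arbitrary: V rule: finite_induct)
    case empty
    then show ?case by (auto simp: flip_def intro: conc_cong)
  next
    case (insert a A)
    let ?f = "\<lambda>V Q. (-1) ^ (card A + card Q) * (\<Prod>k\<in>{card V - card Q..<card V}. r k) * conc (V - Q) Y"
    let ?g = "\<lambda>Q. (-1) ^ (card (insert a A) + card Q) *
      (\<Prod>k\<in>{card V - card Q..<card V}. r k) * conc (V - Q) Y"
    have a: "a \<in> V" and A: "A \<subseteq> V" "A \<subseteq> V - {a}" using insert by auto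
    have cV: "card V \<ge> 1" using a insert.prems(1) by (metis One_nat_def Suc_leI card_gt_0_iff empty_iff)
    have IH: "conc V (flip A Y) = (\<Sum>Q\<in>Pow A. ?f V Q)"
      using insert.IH[of V] insert.prems A by blast
    have IH': "conc (V - {a}) (flip A Y) = (\<Sum>Q\<in>Pow A. ?f (V - {a}) Q)"
      using insert.IH[of "V - {a}"] insert.prems A by blast
    have "conc V (flip (insert a A) Y) = conc V (flip {a} (flip A Y))"
      using insert.hyps by (intro conc_cong insert.prems(1)) (auto simp: flip_def)
    also have "\<dots> = r (card V - 1) * conc (V - {a}) (flip A Y) - conc V (flip A Y)"
      by (rule conc_flip_single[OF insert.prems(1) uniform_rv_flip[OF insert.prems(3)] a])
    also have "\<dots> = (\<Sum>Q\<in>Pow A. r (card V - 1) * ?f (V - {a}) Q) + (\<Sum>Q\<in>Pow A. - ?f V Q)"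
      unfolding IH IH' by (simp only: sum_distrib_left sum_negf)
    \<comment> \<open>Subsets without \<open>a\<close>: the minus sign accounts for the additional
      element in \<open>card (insert a A)\<close>.\<close>
    also have "(\<Sum>Q\<in>Pow A. - ?f V Q) = (\<Sum>Q\<in>Pow A. ?g Q)"
      by (rule sum.cong) (use insert.hyps in auto)
    \<comment> \<open>Subsets containing \<open>a\<close>: both cardinalities in the exponent grow
      by one, so the sign stays.\<close>
    also have "(\<Sum>Q\<in>Pow A. r (card V - 1) * ?f (V - {a}) Q) = (\<Sum>Q\<in>Pow A. ?g (insert a Q))"
    proof (rule sum.cong[OF refl])
      fix Q assume "Q \<in> Pow A"
      then have Q: "finite Q" "a \<notin> Q" "insert a Q \<subseteq> V"
        using insert.hyps A a finite_subset by auto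
      have le: "card Q + 1 \<le> card V"
        using card_mono[OF insert.prems(1) Q(3)] Q(1,2) by simp
      \<comment> \<open>Both ranges start at \<open>card V - card Q - 1\<close>; only the top index
        \<open>card V - 1\<close> is new.\<close>
      have "{card V - card (insert a Q)..<card V} =
          insert (card V - 1) {card (V - {a}) - card Q..<card (V - {a})}"
        using le Q(1,2) a by auto
      then have "(\<Prod>k\<in>{card V - card (insert a Q)..<card V}. r k) =
          r (card V - 1) * (\<Prod>k\<in>{card (V - {a}) - card Q..<card (V - {a})}. r k)"
        using a by simp
      moreover have "V - insert a Q = V - {a} - Q" by blast
      ultimately show "r (card V - 1) * ?f (V - {a}) Q = ?g (insert a Q)"
        using Q(1,2) insert.hyps by simp
    qed
    also have "\<dots> = sum ?g (insert a ` Pow A)"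
    proof (subst sum.reindex)
      show "inj_on (insert a) (Pow A)"
        using insert.hyps(2) by (auto simp: inj_on_def)
    qed (simp only: comp_def)
    also have "sum ?g (insert a ` Pow A) + sum ?g (Pow A) = sum ?g (Pow (insert a A))"
      using insert.hyps by (subst sum.union_disjoint[symmetric]) (auto simp: Pow_insert Un_commute)
    finally show ?case .
  qed
qed

section \<open>Marginals\<close>

text \<open>\<open>proper_copula\<close> numbers the remaining variables by their rank in
  \<open>V\<close>. The inverse of the rank is one numbering of \<open>V\<close>, and by
  \<open>conc_eq\<close> any numbering computes \<open>conc\<close>.\<close>

lemma extended_proper_copula:
  assumes X: "\<And>i. i \<in> {1..n} \<Longrightarrow> uniform_rv M (X i)" and T: "T \<subseteq> {1..n}"
  shows "extended \<kappa> (n - card T) (proper_copula n (joint_cdf M n X) T) = conc ({1..n} - T) X"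
proof -
  define V where "V = {1..n} - T"
  define rank where "rank i = card {k \<in> V. k \<le> i}" for i
  have fin: "finite V" and cV: "card V = n - card T"
    using T by (auto simp: V_def card_Diff_subset finite_subset[OF T])
  have less: "rank i < rank j" if "j \<in> V" "i < j" for i j
  proof -
    have "{k \<in> V. k \<le> i} \<subseteq> {k \<in> V. k \<le> j}" "j \<in> {k \<in> V. k \<le> j}" "j \<notin> {k \<in> V. k \<le> i}"
      using that by auto
    then have "{k \<in> V. k \<le> i} \<subset> {k \<in> V. k \<le> j}" by blast
    then show ?thesis unfolding rank_def using fin by (intro psubset_card_mono) auto
  qed
  have inj: "inj_on rank V"
  proof (rule inj_onI)
    fix i j assume "i \<in> V" "j \<in> V" "rank i = rank j"
    then show "i = j" using less[of j i] less[of i j] by (cases i j rule: linorder_cases) auto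
  qed
  have sub: "rank ` V \<subseteq> {1..card V}"
  proof
    fix k assume "k \<in> rank ` V"
    then obtain i where i: "i \<in> V" "k = rank i" by blast
    have "rank i \<le> card V" unfolding rank_def by (rule card_mono) (use fin in auto)
    moreover have "0 < rank i" unfolding rank_def using i fin by (subst card_gt_0_iff) auto
    ultimately show "k \<in> {1..card V}" using i by simp
  qed
  have bij: "bij_betw rank V {1..card V}"
    unfolding bij_betw_def using inj card_subset_eq[OF _ sub] by (simp add: card_image)
  define g where "g = inv_into V rank"
  have g: "bij_betw g {1..card V} V" unfolding g_def by (rule bij_betw_inv_into[OF bij])
  have "proper_copula n (joint_cdf M n X) T y = joint_cdf M (card V) (\<lambda>i. X (g i)) y"
    if y: "y \<in> cube (card V)" for y
  proof -
    let ?z = "\<lambda>i\<in>{1..n}. if i \<in> T then 1 else y (rank i)"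
    have "y (rank i) \<in> {0..1}" if "i \<in> {1..n}" "i \<notin> T" for i
      using y bij_betwE[OF bij] that by (auto simp: cube_def PiE_iff V_def)
    then have z: "?z \<in> cube n" by (auto simp: cube_def)
    \<comment> \<open>\<open>?z\<close> is already 1 on \<open>T\<close>, so the substitution made
      by \<open>marginal\<close> changes nothing.\<close>
    have zz: "(\<lambda>i\<in>{1..n}. if i \<in> T then 1 else ?z i) = ?z" by auto
    have "proper_copula n (joint_cdf M n X) T y = joint_cdf M n X ?z"
      using y z unfolding cV proper_copula_def marginal_def V_def[symmetric] rank_def[symmetric]
      by (simp only: restrict_apply' zz)
    also have "\<dots> = prob {\<omega> \<in> space M. \<forall>i\<in>{1..n}. X i \<omega> \<le> ?z i}"
      using z by (simp add: joint_cdf_def)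
    \<comment> \<open>The conditions with bound 1 at the indices in \<open>T\<close> hold
      automatically.\<close>
    also have "{\<omega> \<in> space M. \<forall>i\<in>{1..n}. X i \<omega> \<le> ?z i} =
        {\<omega> \<in> space M. \<forall>i\<in>V. X i \<omega> \<le> y (rank i)}"
      using uniform_rv_range[OF X] by (auto simp: V_def)
    also have "\<dots> = {\<omega> \<in> space M. \<forall>i\<in>{1..card V}. X (g i) \<omega> \<le> y i}"
    proof -
      have "(\<forall>i\<in>V. X i \<omega> \<le> y (rank i)) \<longleftrightarrow> (\<forall>i\<in>{1..card V}. X (g i) \<omega> \<le> y i)" for \<omega>
        using bij_betw_inv_into_left[OF bij] bij_betw_inv_into_right[OF bij]
          bij_betwE[OF bij] bij_betwE[OF g]
        unfolding g_def by metis
      then show ?thesis by blast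
    qed
    also have "prob {\<omega> \<in> space M. \<forall>i\<in>{1..card V}. X (g i) \<omega> \<le> y i} =
        joint_cdf M (card V) (\<lambda>i. X (g i)) y"
      using y by (simp add: joint_cdf_def)
    finally show ?thesis .
  qed
  then have "proper_copula n (joint_cdf M n X) T = joint_cdf M (card V) (\<lambda>i. X (g i))"
    by (auto simp: fun_eq_iff proper_copula_def joint_cdf_def cV)
  then show ?thesis
    using conc_eq[OF fin _ g, of X] X by (simp add: V_def[symmetric] cV[symmetric]) (simp add: V_def)
qed

text \<open>With \<open>m = n - card T\<close>, the sum over \<open>j\<close> classifies the subsets
  \<open>Q\<close> of \<open>R\<close> by \<open>j = m - card Q\<close>. Its terms are those of
  \<open>conc_flip\<close> times \<open>(-1) ^ m * r m\<close>: the products in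
  \<open>marginal_sum\<close> include the top factor \<open>r m\<close>, while those in
  \<open>conc_flip\<close> stop at \<open>m - 1\<close>.\<close>

lemma sum_marginal_sum:
  assumes X: "\<And>i. i \<in> {1..n} \<Longrightarrow> uniform_rv M (X i)" and T: "T \<subseteq> {1..n}"
    and R: "R \<subseteq> {1..n} - T" and s: "s + card R = n - card T"
  shows "(\<Sum>j = s..n - card T. (-1) ^ (card R + j) * marginal_sum \<kappa> r n (joint_cdf M n X) j R T) =
    (-1) ^ (n - card T) * r (n - card T) * conc ({1..n} - T) (flip R X)"
proof -
  let ?V = "{1..n} - T" and ?m = "n - card T"
  have finR: "finite R" using R finite_subset by blast
  have finT: "finite T" using T finite_subset by blast
  have cT: "card T \<le> n" using card_mono[OF _ T] by simp
  have cV: "card ?V = ?m" using T finT by (simp add: card_Diff_subset)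
  have cQ: "card Q \<le> card R" if "Q \<subseteq> R" for Q using card_mono[OF finR that] .
  let ?h = "\<lambda>Q. (-1) ^ (card R + (?m - card Q)) * (\<Prod>i\<in>{?m - card Q..?m}. r i) * conc (?V - Q) X"
  have "(\<Sum>j = s..?m. (-1) ^ (card R + j) * marginal_sum \<kappa> r n (joint_cdf M n X) j R T) =
      (\<Sum>j = s..?m. sum ?h {Q \<in> Pow R. ?m - card Q = j})"
  proof (rule sum.cong[OF refl])
    fix j assume j: "j \<in> {s..?m}"
    have idx: "{Q. Q \<subseteq> R - T \<and> card Q + j + card T = n} = {Q \<in> Pow R. ?m - card Q = j}"
    proof -
      have "R - T = R" using R by blast
      \<comment> \<open>\<open>card Q \<le> card R \<le> n - card T\<close>, so the subtraction of
        naturals is exact.\<close>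
      moreover have "card Q + j + card T = n \<longleftrightarrow> ?m - card Q = j" if "Q \<subseteq> R" for Q
        using cQ[OF that] s j cT by auto
      ultimately show ?thesis by auto
    qed
    have "(-1) ^ (card R + j) * (\<Prod>i\<in>{j..?m}. r i) *
        extended \<kappa> j (proper_copula n (joint_cdf M n X) (Q \<union> T)) = ?h Q"
      if Q: "Q \<in> {Q \<in> Pow R. ?m - card Q = j}" for Q
    proof -
      have QT: "Q \<union> T \<subseteq> {1..n}" "Q \<inter> T = {}" "finite Q"
        using Q R T finR finite_subset by auto
      have "n - card (Q \<union> T) = j"
        using Q QT finT by (auto simp: card_Un_disjoint)
      moreover have "{1..n} - (Q \<union> T) = ?V - Q" by blast
      ultimately show ?thesis
        using extended_proper_copula[OF X QT(1)] Q by simp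
    qed
    then show "(-1) ^ (card R + j) * marginal_sum \<kappa> r n (joint_cdf M n X) j R T =
        sum ?h {Q \<in> Pow R. ?m - card Q = j}"
      unfolding marginal_sum_def idx sum_distrib_left mult.assoc[symmetric] by (rule sum.cong[OF refl])
  qed
  \<comment> \<open>Every \<open>Q \<subseteq> R\<close> has \<open>?m - card Q\<close> between
    \<open>s\<close> and \<open>?m\<close>, so the classes exhaust \<open>Pow R\<close>.\<close>
  also have "\<dots> = sum ?h (Pow R)"
    by (rule sum.group) (use finR s cQ in \<open>auto simp: le_diff_conv2 dest!: cQ\<close>)
  also have "\<dots> = (-1) ^ ?m * r ?m * conc ?V (flip R X)"
  proof -
    have "?h Q = (-1) ^ ?m * r ?m *
        ((-1) ^ (card R + card Q) * (\<Prod>k\<in>{card ?V - card Q..<card ?V}. r k) * conc (?V - Q) X)"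
      if "Q \<in> Pow R" for Q
    proof -
      have le: "card Q \<le> ?m" using cQ[of Q] that s by simp
      have "{?m - card Q..?m} = insert ?m {?m - card Q..<?m}" by auto
      then have "(\<Prod>i\<in>{?m - card Q..?m}. r i) = r ?m * (\<Prod>k\<in>{?m - card Q..<?m}. r k)" by simp
      moreover have "(-1::real) ^ (card R + (?m - card Q)) = (-1) ^ ?m * (-1) ^ (card R + card Q)"
      proof -
        \<comment> \<open>Adding \<open>2 * card Q\<close> keeps the parity and cancels the
          subtraction.\<close>
        have "card R + (?m - card Q) + 2 * card Q = ?m + (card R + card Q)" using le by simp
        then have "even (card R + (?m - card Q) + 2 * card Q) \<longleftrightarrow> even (?m + (card R + card Q))"
          by (rule arg_cong)
        then have "even (card R + (?m - card Q)) \<longleftrightarrow> even (?m + (card R + card Q))" by simp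
        then show ?thesis by (simp add: power_add[symmetric] minus_one_power_iff)
      qed
      ultimately show ?thesis unfolding cV by simp
    qed
    then have "sum ?h (Pow R) = (-1) ^ ?m * r ?m * (\<Sum>Q\<in>Pow R. (-1) ^ (card R + card Q) *
        (\<Prod>k\<in>{card ?V - card Q..<card ?V}. r k) * conc (?V - Q) X)"
      unfolding sum_distrib_left by (rule sum.cong[OF refl])
    also have "\<dots> = (-1) ^ ?m * r ?m * conc ?V (flip R X)"
      using X by (subst conc_flip[OF _ R]) auto
    finally show ?thesis .
  qed
  finally show ?thesis .
qed

end

lemma copula_as_joint_cdf:
  assumes C: "copula n C" and \<mu>: "represents_copula n C \<mu>"
  shows "C = joint_cdf \<mu> n (\<lambda>i x. x i)" and "i \<in> {1..n} \<Longrightarrow> uniform_rv \<mu> (\<lambda>x. x i)"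
proof -
  have sets: "sets \<mu> = sets (Pi\<^sub>M {1..n} (\<lambda>_. unit_borel))"
    using \<mu> by (simp only: represents_copula_def)
  then have space: "space \<mu> = cube n"
    using sets_eq_imp_space_eq space_PiM_unit_borel by metis
  show "i \<in> {1..n} \<Longrightarrow> uniform_rv \<mu> (\<lambda>x. x i)"
    using \<mu> measurable_component_singleton[of i "{1..n}" "\<lambda>_. unit_borel"]
    by (simp add: uniform_rv_def represents_copula_def measurable_cong_sets[OF sets refl])
  show "C = joint_cdf \<mu> n (\<lambda>i x. x i)"
  proof
    fix x
    show "C x = joint_cdf \<mu> n (\<lambda>i x. x i) x"
    proof (cases "x \<in> cube n")
      case True
      \<comment> \<open>Points of the space lie in the cube, so the lower bounds of the box hold
        automatically.\<close>
      have "{y \<in> space \<mu>. \<forall>i\<in>{1..n}. y i \<le> x i} = origin_box n x"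
        using True unfolding space by (fastforce simp: cube_def origin_box_def PiE_iff)
      then show ?thesis using True \<mu> by (simp add: joint_cdf_def represents_copula_def)
    next
      case False
      then show ?thesis using C by (auto simp: copula_def joint_cdf_def PiE_iff extensional_def)
    qed
  qed
qed

theorem theorem5:
  fixes n :: nat and C :: "point \<Rightarrow> real" and R S T :: "nat set"
    and \<kappa> :: "nat \<Rightarrow> (point \<Rightarrow> real) \<Rightarrow> real" and r :: "nat \<Rightarrow> real"
  assumes "copula n C"
    and "R \<inter> S = {}" and "R \<inter> T = {}" and "S \<inter> T = {}"
    and "{1..n} = R \<union> S \<union> T"
    and "measure_of_concordance \<kappa> r"
  shows "(\<Sum>j = card S..n - card T. (-1) ^ (card R + j) * marginal_sum \<kappa> r n C j R T) =
         (\<Sum>j = card R..n - card T. (-1) ^ (card S + j) * marginal_sum \<kappa> r n C j S T)"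
proof -
  obtain \<mu> where \<mu>: "represents_copula n C \<mu>" using assms(1) by (auto simp: copula_def)
  define X where "X = (\<lambda>i (x :: point). x i)"
  have C: "C = joint_cdf \<mu> n X" and X: "\<And>i. i \<in> {1..n} \<Longrightarrow> uniform_rv \<mu> (X i)"
    using copula_as_joint_cdf[OF assms(1) \<mu>] by (simp_all add: X_def)
  interpret measure_of_concordance \<kappa> r by (rule assms(6))
  interpret prob_space \<mu> using \<mu> by (simp add: represents_copula_def)
  interpret uniform_concordance \<kappa> r \<mu> by unfold_locales
  have fin: "finite R" "finite S" "finite T"
    using assms(5) finite_atLeastAtMost[of 1 n] by (simp_all only: finite_Un)
  have sub: "T \<subseteq> {1..n}" "R \<subseteq> {1..n} - T" "S \<subseteq> {1..n} - T"
    and V: "{1..n} - T = R \<union> S"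
    using assms(2-5) by auto
  have "card R + card S = n - card T"
    using card_Diff_subset[OF fin(3) sub(1)] card_Un_disjoint[OF fin(1,2) assms(2)]
    by (simp only: V card_atLeastAtMost diff_Suc_1)
  \<comment> \<open>Both orders are recorded because \<open>R\<close> and \<open>S\<close> exchange
    roles in \<open>sum_marginal_sum\<close>.\<close>
  then have card: "card S + card R = n - card T" "card R + card S = n - card T" by simp_all
  have R: "(\<Sum>j = card S..n - card T. (-1) ^ (card R + j) * marginal_sum \<kappa> r n C j R T) =
      (-1) ^ (n - card T) * r (n - card T) * conc ({1..n} - T) (flip R X)"
    unfolding C by (rule sum_marginal_sum[OF _ sub(1,2) card(1)]) (rule X)
  have S: "(\<Sum>j = card R..n - card T. (-1) ^ (card S + j) * marginal_sum \<kappa> r n C j S T) =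
      (-1) ^ (n - card T) * r (n - card T) * conc ({1..n} - T) (flip S X)"
    unfolding C by (rule sum_marginal_sum[OF _ sub(1,3) card(2)]) (rule X)
  have "conc ({1..n} - T) (flip R X) = conc ({1..n} - T) (flip ({1..n} - T) (flip R X))"
    by (rule conc_flip_all[symmetric]) (use X in \<open>auto intro: uniform_rv_flip\<close>)
  \<comment> \<open>On \<open>R \<union> S\<close> the full reflection undoes the reflection in
    \<open>R\<close> and performs the one in \<open>S\<close>.\<close>
  also have "\<dots> = conc ({1..n} - T) (flip S X)"
    by (rule conc_cong) (use V fin assms(2) in \<open>auto simp: flip_def\<close>)
  finally show ?thesis by (simp only: R S)
qed

end
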